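(* Let $\bm\mu$ be an Angelesco system on the unit circle with arcs $\Gamma_1,\dots,\Gamma_r$ and the associated square-root branch (see context). Let $\bm n\in\mathbb N^r$, $\tau\in\partial\mathbb D$ and let $X\not\equiv0$ be a $\tau$-invariant paraorthogonal function for $\bm n$. Then the polynomial $z^{(|\bm n|+1)/2}X(z)$ has $|\bm n|+1$ zeros, all simple and lying on the unit circle, and at most one of them lies outside $\bigcup_{j=1}^r\operatorname{Int}(\Gamma_j)$, where $\operatorname{Int}(\Gamma_j)$ is the arc $\Gamma_j$ without its endpoints.
   Context: $\partial\mathbb D=\{|z|=1\}$; measures are finite, positive, Borel, with infinite support. Angelesco system: closed arcs $\Gamma_j\subset\partial\mathbb D$ with $\operatorname{supp}\mu_j\subseteq\Gamma_j$ and $\Gamma_j\cap\Gamma_k$ contained in the set of endpoints for $j\ne k$; $t_0\in\mathbb R$ and the ordering of the arcs are such that $t_0\le\theta_1\le\dots\le\theta_r\le t_0+2\pi$ whenever $e^{i\theta_k}\in\Gamma_k$; $\mu_r$ has no point mass at $e^{it_0}$. Branch: $z^{k/2}=|z|^{k/2}\exp(ik\arg_{[t_0,t_0+2\pi)}(z)/2)$, $k\in\mathbb Z$. $|\bm n|=\sum_j n_j$; $\operatorname{span}\{z^p\}_{p=a}^b$ ($b-a\in\mathbb Z$) is the span of $z^a,\dots,z^b$. A $\tau$-invariant paraorthogonal function for $\bm n$ is any $X\in\operatorname{span}\{z^p\}_{p=-(|\bm n|+1)/2}^{(|\bm n|+1)/2}$ with $X(z)=\tau\overline{X(1/\bar z)}$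 and $\int X(z)z^{-p}\,d\mu_j(z)=0$ for $p=-(n_j-1)/2,\dots,(n_j-1)/2$, $j=1,\dots,r$. *)

theory Defs
  imports "HOL-Analysis.Analysis" "HOL-Computational_Algebra.Polynomial"
begin

definition arg_br :: "real \<Rightarrow> complex \<Rightarrow> real" where
  "arg_br t0 z = t0 + (let s = Arg (z * cis (- t0)) in if s < 0 then s + 2 * pi else s)"

definition halfpow :: "real \<Rightarrow> int \<Rightarrow> complex \<Rightarrow> complex" where
  "halfpow t0 k z = complex_of_real (norm z powr (real_of_int k / 2))
      * exp (\<i> * complex_of_real (real_of_int k * arg_br t0 z / 2))"

definition span_fun :: "real \<Rightarrow> nat \<Rightarrow> (nat \<Rightarrow> complex) \<Rightarrow> complex \<Rightarrow> complex" where
  "span_fun t0 N c z = (\<Sum>k\<le>N+1. c k * halfpow t0 (2 * int k - (int N + 1)) z)"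

definition msupp :: "complex measure \<Rightarrow> complex set" where
  "msupp M = {z. \<forall>e>0. emeasure M (ball z e) \<noteq> 0}"

definition arc :: "real \<Rightarrow> real \<Rightarrow> complex set" where
  "arc a b = cis ` {a..b}"

definition arc_int :: "real \<Rightarrow> real \<Rightarrow> complex set" where
  "arc_int a b = cis ` {a<..<b}"

end

theory Submission
  imports Defs
begin

text \<open>
  On the circle, \<open>X\<close> divided by a square root of \<open>\<tau>\<close> is a real trigonometric polynomial in the
  angle \<open>x\<close>. If it had fewer than \<open>n\<^sub>j\<close> zeros of odd order inside the arc \<open>\<Gamma>\<^sub>j\<close>, multiplying it by the
  product of \<open>sin ((x - s) / 2)\<close> over these zeros \<open>s\<close> (and over the left endpoint of the arc, if the
  parity is wrong) would give a function of constant sign on the arc, while the second factor lies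
  in the span to which \<open>X\<close> is orthogonal. So there are at least \<open>N = |n|\<close> zeros of odd order in the
  open arcs. The polynomial has degree \<open>N + 1\<close> by self-reciprocity, so exactly one root is left;
  it is a new one because the orders are odd, and it lies on the circle because its reflection
  is again a root.
\<close>

section \<open>The angle parametrization of the circle and the half-integer powers\<close>

text \<open>Pulling out the half-sum angle leaves a purely imaginary difference. This links a root
  of a polynomial on the circle to a real sine factor, whose sign can be followed.\<close>

lemma cis_diff_eq:
  "cis x - cis y = 2 * \<i> * complex_of_real (sin ((x - y) / 2)) * cis ((x + y) / 2)"
proof -
  define u v where "u = (x + y) / 2" and "v = (x - y) / 2"
  have "x = u + v" "y = u - v"
    by (auto simp: u_def v_def field_simps)
  then show ?thesis
    unfolding u_def[symmetric] v_def[symmetric]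
    by (simp add: complex_eq_iff cos_add sin_add cos_diff sin_diff)
qed

lemma cis_inj_close:
  assumes "cis x = cis y" "\<bar>x - y\<bar> < 2 * pi"
  shows "x = y"
proof -
  have "sin ((x - y) / 2) = 0"
    using assms(1) cis_diff_eq[of x y] by simp
  then show ?thesis
    using assms(2) sin_eq_0_pi[of "(x - y) / 2"] by auto
qed

lemma inj_on_cis_interval: "b \<le> a + 2 * pi \<Longrightarrow> inj_on cis {a<..<b}"
  by (rule inj_onI, rule cis_inj_close) (auto simp: abs_if)

lemma arg_br_cis:
  assumes "t0 \<le> x" "x < t0 + 2 * pi"
  shows "arg_br t0 (cis x) = x"
proof (cases "x - t0 \<le> pi")
  case True
  then have "Arg (cis (x - t0)) = x - t0"
    using assms pi_gt_zero by (intro Arg_cis) (auto simp del: pi_gt_zero)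
  then show ?thesis
    using assms by (simp add: arg_br_def cis_mult)
next
  case False
  \<comment> \<open>Past \<open>pi\<close> the principal argument is lower by \<open>2 * pi\<close>;
    the case \<open>s < 0\<close> in \<open>arg_br\<close> restores that turn.\<close>
  have "cis (x - t0) = cis (x - t0 - 2 * pi)"
    by (simp add: complex_eq_iff cos_diff sin_diff)
  then have "Arg (cis (x - t0)) = x - t0 - 2 * pi"
    using assms False Arg_cis[of "x - t0 - 2 * pi"] by auto
  then show ?thesis
    using assms by (simp add: arg_br_def cis_mult)
qed

lemma halfpow_cis:
  assumes "t0 \<le> x" "x < t0 + 2 * pi"
  shows "halfpow t0 k (cis x) = cis (real_of_int k * x / 2)"
  by (simp add: halfpow_def arg_br_cis[OF assms]) (simp add: cis_conv_exp)

lemma halfpow_add: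
  assumes "z \<noteq> 0"
  shows "halfpow t0 (k + l) z = halfpow t0 k z * halfpow t0 l z"
  using assms
  by (simp add: halfpow_def powr_add add_divide_distrib exp_add[symmetric] ring_distribs)

text \<open>For an even index no square root is taken, so the branch drops out: whatever
  \<open>t0\<close> is, \<open>cis (arg_br t0 z)\<close> is \<open>sgn z\<close>.\<close>

lemma halfpow_even:
  assumes "z \<noteq> 0"
  shows "halfpow t0 (2 * int k) z = z ^ k"
proof -
  have cis_arg: "cis (arg_br t0 z) = sgn z"
  proof -
    have "cis (arg_br t0 z) = cis t0 * cis (Arg (z * cis (- t0)))"
      by (auto simp: arg_br_def Let_def cis_mult complex_eq_iff cos_add sin_add)
    also have "\<dots> = cis t0 * sgn (z * cis (- t0))"
      using assms by (simp add: cis_Arg)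
    also have "\<dots> = sgn z"
      by (simp add: sgn_mult sgn_eq norm_mult cis_mult algebra_simps flip: cis_mult) (simp add: cis_mult)
    finally show ?thesis .
  qed
  have "halfpow t0 (2 * int k) z = complex_of_real (norm z ^ k) * cis (arg_br t0 z) ^ k"
    using assms by (simp add: halfpow_def powr_realpow Complex.DeMoivre) (simp add: cis_conv_exp)
  also have "\<dots> = (complex_of_real (norm z) * sgn z) ^ k"
    by (simp add: cis_arg power_mult_distrib)
  also have "complex_of_real (norm z) * sgn z = z"
    using assms by (simp add: sgn_eq)
  finally show ?thesis .
qed

text \<open>Reflection in the circle keeps the argument, hence also the branch, and inverts the
  modulus. Conjugation then negates the angle, so modulus and angle both see the exponent
  \<open>- k\<close>.\<close>

lemma cnj_halfpow_reflect:
  assumes "z \<noteq> 0"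
  shows "cnj (halfpow t0 k (1 / cnj z)) = halfpow t0 (- k) z"
proof -
  have eq: "1 / cnj z = of_real (inverse ((norm z)\<^sup>2)) * z"
    using assms by (simp add: field_simps complex_norm_square[symmetric] flip: of_real_power)
  have "Arg (1 / cnj z * cis (- t0)) = Arg (z * cis (- t0))"
    unfolding eq mult.assoc using assms by (subst Arg_times_of_real) auto
  then have "arg_br t0 (1 / cnj z) = arg_br t0 z"
    by (simp add: arg_br_def)
  then show ?thesis
    using assms
    by (simp add: halfpow_def norm_divide powr_divide powr_minus_divide exp_cnj powr_minus)
qed

text \<open>\<open>Arg\<close> is continuous off the closed negative real axis and has the constant
  value \<open>pi\<close> on that axis without 0, so it is piecewise Borel.\<close>

lemma measurable_halfpow [measurable]: "halfpow t0 k \<in> borel_measurable borel"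
proof -
  have "Arg \<in> borel_measurable borel"
  proof -
    have [measurable]: "(\<lambda>z. if z \<in> - \<real>\<^sub>\<le>\<^sub>0 then Arg z else pi) \<in> borel_measurable borel"
      by (intro borel_measurable_continuous_on_if continuous_on_Arg) auto
    have "(\<lambda>z. if z = 0 then 0 else if z \<in> - \<real>\<^sub>\<le>\<^sub>0 then Arg z else pi) \<in> borel_measurable borel"
      by measurable
    moreover have Arg_eq: "Arg z = (if z = 0 then 0 else if z \<in> - \<real>\<^sub>\<le>\<^sub>0 then Arg z else pi)" for z
    proof (cases "z = 0 \<or> z \<in> - \<real>\<^sub>\<le>\<^sub>0")
      case False
      then have "Re z < 0" "Im z = 0"
        by (auto simp: complex_nonpos_Reals_iff less_le complex_eq_iff)
      then have "Arg z = pi" by (simp add: Arg_eq_pi)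
      then show ?thesis using False by simp
    qed (auto simp: Arg_zero)
    then have "Arg = (\<lambda>z. if z = 0 then 0 else if z \<in> - \<real>\<^sub>\<le>\<^sub>0 then Arg z else pi)"
      by blast
    ultimately show ?thesis by metis
  qed
  note [measurable] = this
  show ?thesis
    unfolding halfpow_def arg_br_def Let_def by measurable
qed

section \<open>The support of a Borel measure\<close>

lemma compl_msupp: "- msupp M = \<Union>{U. open U \<and> emeasure M U = 0}" if "sets M = sets borel"
proof (intro subset_antisym subsetI)
  fix z assume "z \<in> \<Union>{U. open U \<and> emeasure M U = 0}"
  then obtain U where U: "open U" "emeasure M U = 0" "z \<in> U"
    by auto
  then obtain e where "e > 0" "ball z e \<subseteq> U"
    using open_contains_ball by blast
  then show "z \<in> - msupp M"
    using emeasure_mono[of "ball z e" U M] U that by (auto simp: msupp_def)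
qed (auto simp: msupp_def)

text \<open>The complement is a union of open null sets; by the Lindelof property countably many of
  them suffice.\<close>

lemma compl_msupp_null_set:
  assumes "sets M = sets borel"
  shows "- msupp M \<in> null_sets M"
proof -
  define F where "F = {U. open U \<and> emeasure M U = 0}"
  obtain F' where F': "F' \<subseteq> F" "countable F'" "\<Union>F' = \<Union>F"
    using Lindelof[of F] by (auto simp: F_def)
  have "(\<Union>U\<in>F'. U) \<in> null_sets M"
    using F' assms
    by (intro null_sets_UN') (auto simp: F_def null_sets_def)
  then show ?thesis
    using F'(3) by (simp add: compl_msupp[OF assms] F_def)
qed

text \<open>A support point off \<open>Z\<close> would have a ball that avoids \<open>Z\<close> and
  yet has positive measure. Applied to a finite \<open>Z\<close>, this contradicts infinite
  support.\<close>

lemma msupp_subset_closed: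
  assumes "sets M = sets borel" "closed Z" "AE z in M. z \<in> Z"
  shows "msupp M \<subseteq> Z"
proof (rule ccontr)
  assume "\<not> msupp M \<subseteq> Z"
  then obtain z where z: "z \<in> msupp M" "z \<in> - Z" by auto
  then obtain e where e: "e > 0" "ball z e \<subseteq> - Z"
    using assms(2) open_contains_ball[of "- Z"] by auto
  have "AE x in M. x \<notin> ball z e"
    using assms(3) by eventually_elim (use e in auto)
  then have "emeasure M (ball z e) = 0"
    using assms(1) sets_eq_imp_space_eq[OF assms(1)]
    by (subst (asm) AE_iff_measurable[where N = "ball z e"]) auto
  then show False using z e by (auto simp: msupp_def)
qed

section \<open>Sine products and sign changes on an interval\<close>

text \<open>By \<open>cis_diff_eq\<close> each sine is a linear polynomial in \<open>cis x\<close>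
  up to a constant and the factor \<open>cis (- x / 2)\<close>. This form lets a product of sines
  serve as a test function in the orthogonality relations.\<close>

lemma prod_sin_eq_poly:
  assumes "finite S"
  shows "\<exists>D :: complex poly. degree D \<le> card S \<and>
    (\<forall>x. complex_of_real (\<Prod>s\<in>S. sin ((x - s) / 2)) = cis (- real (card S) * x / 2) * poly D (cis x))"
  using assms
proof (induction S rule: finite_induct)
  case empty
  show ?case by (rule exI[of _ 1]) simp
next
  case (insert s S)
  then obtain D where D: "degree D \<le> card S"
    "\<And>x. complex_of_real (\<Prod>s\<in>S. sin ((x - s) / 2)) = cis (- real (card S) * x / 2) * poly D (cis x)"
    by blast
  define L where "L = [:- cis s, 1:]"
  \<comment> \<open>The constant cancels the factor \<open>2 * \<i>\<close> of
    \<open>cis_diff_eq\<close> and the part of its half-sum angle that comes from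
    \<open>s\<close>.\<close>
  define k where "k = cis (- s / 2) / (2 * \<i>)"
  then have "k * (2 * \<i>) = cis (- s / 2)"
    by (metis complex_i_not_zero mult_eq_0_iff nonzero_divide_eq_eq zero_neq_numeral)
  have "complex_of_real (sin ((x - s) / 2)) = k * cis (- x / 2) * poly L (cis x)" for x
  proof -
    have "poly L (cis x) = 2 * \<i> * complex_of_real (sin ((x - s) / 2)) * cis ((x + s) / 2)"
      by (simp add: L_def flip: cis_diff_eq)
    then have "k * cis (- x / 2) * poly L (cis x)
        = (cis (- s / 2) * cis (- x / 2) * cis ((x + s) / 2)) * complex_of_real (sin ((x - s) / 2))"
      using \<open>k * (2 * \<i>) = cis (- s / 2)\<close> by algebra
    also have "cis (- s / 2) * cis (- x / 2) * cis ((x + s) / 2) = 1"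
      by (simp add: cis_mult add_divide_distrib)
    finally show ?thesis by simp
  qed
  then have "complex_of_real (\<Prod>s\<in>insert s S. sin ((x - s) / 2))
      = (cis (- x / 2) * cis (- real (card S) * x / 2)) * poly (smult k (L * D)) (cis x)" for x
    using insert.hyps D(2)[of x] by simp
  moreover have "cis (- x / 2) * cis (- real (card S) * x / 2) = cis (- real (card (insert s S)) * x / 2)" for x
    using insert.hyps by (simp add: cis_mult field_simps)
  ultimately have "complex_of_real (\<Prod>s\<in>insert s S. sin ((x - s) / 2))
      = cis (- real (card (insert s S)) * x / 2) * poly (smult k (L * D)) (cis x)" for x
    by metis
  moreover have "degree (smult k (L * D)) \<le> card (insert s S)"
    using D(1) insert.hyps degree_mult_le[of L D] degree_smult_le[of k "L * D"] by (auto simp: L_def)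
  ultimately show ?case by blast
qed

lemma order_mult_linear:
  fixes Q :: "complex poly"
  assumes "Q \<noteq> 0"
  shows "order z ([:- w, 1:] * Q) = (if z = w then 1 else 0) + order z Q"
proof -
  have "order z [:- w, 1:] = (if z = w then 1 else 0)"
    using order_power_n_n[of w 1] order_root[of "[:- w, 1:]" z] by auto
  moreover have "[:- w, 1:] * Q \<noteq> 0"
    unfolding mult_eq_0_iff using assms by simp
  then have "order z ([:- w, 1:] * Q) = order z [:- w, 1:] + order z Q"
    by (rule order_mult)
  ultimately show ?thesis by (simp only:)
qed

lemma finite_odd_order:
  assumes "P \<noteq> 0" "b \<le> a + 2 * pi"
  shows "finite {x \<in> {a<..<b}. odd (order (cis x) P)}"
proof (rule finite_imageD)
  have "cis ` {x \<in> {a<..<b}. odd (order (cis x) P)} \<subseteq> {z. poly P z = 0}"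
    using assms(1) by (auto simp: order_root intro!: odd_pos)
  then show "finite (cis ` {x \<in> {a<..<b}. odd (order (cis x) P)})"
    using poly_roots_finite[OF assms(1)] finite_subset by blast
  show "inj_on cis {x \<in> {a<..<b}. odd (order (cis x) P)}"
    by (rule inj_on_subset[OF inj_on_cis_interval[OF assms(2)]]) auto
qed

lemma constant_sign_off_zeros:
  fixes f :: "real \<Rightarrow> real"
  assumes "continuous_on {a<..<b} f" "\<And>x. x \<in> {a<..<b} \<Longrightarrow> f x \<noteq> 0"
  shows "\<exists>e\<in>{1, - 1}. \<forall>x\<in>{a<..<b}. 0 \<le> e * f x"
proof (rule ccontr)
  assume "\<not> ?thesis"
  then obtain x y where xy: "x \<in> {a<..<b}" "y \<in> {a<..<b}" "f x < 0" "f y > 0"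
    by (auto simp: not_le)
  have "connected (f ` {a<..<b})"
    using assms(1) by (intro connected_continuous_image) auto
  then have "0 \<in> f ` {a<..<b}"
    using xy by (meson connectedD_interval image_eqI less_imp_le)
  then show False using assms(2) by auto
qed

text \<open>
  Induction on the degree: dividing out a root \<open>cis y\<close> of \<open>P\<close> splits off the real factor
  \<open>sin ((x - y) / 2)\<close>, shifts \<open>d\<close> by \<open>1 / 2\<close> and toggles membership of \<open>y\<close> in the index set.
\<close>

lemma constant_sign_odd_zeros:
  fixes P :: "complex poly"
  assumes "P \<noteq> 0" "C \<noteq> 0" "a < b" "b \<le> a + 2 * pi"
    and "\<forall>x\<in>{a<..<b}. Im (C * cis (- d * x) * poly P (cis x)) = 0"
  shows "\<exists>e\<in>{1, - 1}. \<forall>x\<in>{a<..<b}. 0 \<le> e * (Re (C * cis (- d * x) * poly P (cis x))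
     * (\<Prod>s\<in>{x \<in> {a<..<b}. odd (order (cis x) P)}. sin ((x - s) / 2)))"
  using assms
proof (induction "degree P" arbitrary: P C d rule: less_induct)
  case less
  define g where "g = (\<lambda>x. C * cis (- d * x) * poly P (cis x))"
  have g_cont: "continuous_on UNIV g"
    unfolding g_def by (intro continuous_intros)
  show ?case
  proof (cases "\<exists>y\<in>{a<..<b}. poly P (cis y) = 0")
    case False
    then have nz: "g x \<noteq> 0" "order (cis x) P = 0" if "x \<in> {a<..<b}" for x
      using that less.prems(1,2) by (auto simp: g_def order_root)
    have "\<exists>e\<in>{1, - 1}. \<forall>x\<in>{a<..<b}. 0 \<le> e * Re (g x)"
    proof (rule constant_sign_off_zeros)
      show "continuous_on {a<..<b} (\<lambda>x. Re (g x))"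
        by (intro continuous_intros continuous_on_subset[OF g_cont]) auto
      show "Re (g x) \<noteq> 0" if "x \<in> {a<..<b}" for x
        using nz(1)[OF that] less.prems(5) that by (auto simp: g_def complex_eq_iff)
    qed
    moreover have "{x \<in> {a<..<b}. odd (order (cis x) P)} = {}"
      using nz(2) by auto
    ultimately show ?thesis
      by (simp only: g_def prod.empty mult_1_right)
  next
    case True
    then obtain y where y: "y \<in> {a<..<b}" "poly P (cis y) = 0" by blast
    then obtain Q where Q: "P = [:- cis y, 1:] * Q"
      by (auto simp: poly_eq_0_iff_dvd dvd_def)
    have "Q \<noteq> 0" using Q less.prems(1) by auto
    have deg: "degree Q < degree P"
      using \<open>Q \<noteq> 0\<close> unfolding Q by (subst degree_mult_eq) auto
    define C' where "C' = 2 * \<i> * C * cis (y / 2)"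
    define h where "h = (\<lambda>x. C' * cis (- (d - 1 / 2) * x) * poly Q (cis x))"
    have gh: "g x = complex_of_real (sin ((x - y) / 2)) * h x" for x
    proof -
      have "g x = C * cis (- d * x) * (cis x - cis y) * poly Q (cis x)"
        by (simp add: g_def Q algebra_simps)
      also have "\<dots> = 2 * \<i> * C * (cis (- d * x) * cis ((x + y) / 2)) * poly Q (cis x)
          * complex_of_real (sin ((x - y) / 2))"
        by (simp add: cis_diff_eq)
      also have "cis (- d * x) * cis ((x + y) / 2) = cis (y / 2) * cis (- (d - 1 / 2) * x)"
        by (simp add: cis_mult field_simps)
      finally show ?thesis by (simp add: h_def C'_def)
    qed
    have sin_nz: "sin ((x - y) / 2) \<noteq> 0" if "x \<in> {a<..<b}" "x \<noteq> y" for x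
      using sin_eq_0_pi[of "(x - y) / 2"] that y(1) less.prems(4) by auto
    have h_real: "Im (h x) = 0" if x: "x \<in> {a<..<b}" for x
    proof (cases "x = y")
      case False
      have "Im (g x) = sin ((x - y) / 2) * Im (h x)" by (simp add: gh)
      then show ?thesis
        using less.prems(5) x sin_nz[OF x False] by (auto simp: g_def)
    next
      case True
      \<comment> \<open>At \<open>y\<close> the sine vanishes and \<open>g\<close> says nothing
        about \<open>h\<close>; reality there follows by continuity from the neighbouring
        points.\<close>
      have "continuous_on UNIV (\<lambda>x. Im (h x))"
        unfolding h_def by (intro continuous_intros)
      then have "((\<lambda>x. Im (h x)) \<longlongrightarrow> Im (h y)) (at y)"
        by (simp add: continuous_on_def)
      moreover have "\<forall>\<^sub>F x in at y. Im (h x) = 0"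
      proof -
        have "\<forall>\<^sub>F x in at y. x \<in> {a<..<b} - {y}"
          using y(1) eventually_at_in_open[of "{a<..<b}" y] by auto
        then show ?thesis
        proof eventually_elim
          case (elim x)
          have "Im (g x) = sin ((x - y) / 2) * Im (h x)" by (simp add: gh)
          then show ?case
            using less.prems(5) elim sin_nz[of x] by (auto simp: g_def)
        qed
      qed
      ultimately have "((\<lambda>x. 0) \<longlongrightarrow> Im (h y)) (at y)"
        using tendsto_cong by force
      then show ?thesis using True by (simp add: tendsto_const_iff)
    qed
    define S T where "S = {x \<in> {a<..<b}. odd (order (cis x) P)}"
      and "T = {x \<in> {a<..<b}. odd (order (cis x) Q)}"
    have fin: "finite S" "finite T"
      using finite_odd_order less.prems(1,4) \<open>Q \<noteq> 0\<close> by (auto simp: S_def T_def)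
    have ord: "order (cis x) P = (if x = y then 1 else 0) + order (cis x) Q" if "x \<in> {a<..<b}" for x
      using that y(1) inj_on_cis_interval[OF less.prems(4)] \<open>Q \<noteq> 0\<close>
      unfolding Q by (subst order_mult_linear) (auto dest: inj_onD)
    have ST: "x \<in> S \<longleftrightarrow> (x \<in> T \<longleftrightarrow> x \<noteq> y)" if "x \<in> {a<..<b}" for x
      using that ord[OF that] by (auto simp: S_def T_def)
    have C': "C' \<noteq> 0" using less.prems(2) by (simp add: C'_def)
    obtain e where e: "e \<in> {1, - 1}"
      "\<And>x. x \<in> {a<..<b} \<Longrightarrow> 0 \<le> e * (Re (h x) * (\<Prod>s\<in>T. sin ((x - s) / 2)))"
      using less.hyps[OF deg \<open>Q \<noteq> 0\<close> C' less.prems(3,4), of "d - 1 / 2"] h_real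
      unfolding h_def T_def by blast
    have "0 \<le> e * (Re (g x) * (\<Prod>s\<in>S. sin ((x - s) / 2)))" if x: "x \<in> {a<..<b}" for x
    proof (cases "y \<in> T")
      case True
      then have "T = insert y S" "y \<notin> S"
        using ST y(1) by (auto simp: S_def T_def)
      then have "Re (g x) * (\<Prod>s\<in>S. sin ((x - s) / 2)) = Re (h x) * (\<Prod>s\<in>T. sin ((x - s) / 2))"
        using fin by (simp add: gh)
      then show ?thesis using e(2)[OF x] by simp
    next
      case False
      then have "S = insert y T"
        using ST y(1) by (auto simp: S_def T_def)
      \<comment> \<open>The sine at \<open>y\<close> occurs once in \<open>g\<close> and once in the
        product over \<open>S\<close>, so only its square is added.\<close>
      then have "e * (Re (g x) * (\<Prod>s\<in>S. sin ((x - s) / 2)))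
          = (e * (Re (h x) * (\<Prod>s\<in>T. sin ((x - s) / 2)))) * (sin ((x - y) / 2))\<^sup>2"
        using fin False by (simp add: gh power2_eq_square)
      then show ?thesis
        using mult_nonneg_nonneg[OF e(2)[OF x] zero_le_power2[of "sin ((x - y) / 2)"]] by presburger
    qed
    then show ?thesis
      using e(1) unfolding S_def g_def by blast
  qed
qed

section \<open>The polynomial attached to a paraorthogonal function\<close>

text \<open>This is the polynomial z^((N+1)/2) X(z) for the function X with coefficients
  \<open>c\<close>.\<close>

definition span_poly :: "nat \<Rightarrow> (nat \<Rightarrow> complex) \<Rightarrow> complex poly" where
  "span_poly N c = (\<Sum>k\<le>N+1. monom (c k) k)"

lemma poly_span_poly: "poly (span_poly N c) z = (\<Sum>k\<le>N+1. c k * z ^ k)"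
  by (simp add: span_poly_def poly_sum poly_monom)

lemma coeff_span_poly: "coeff (span_poly N c) k = (if k \<le> N + 1 then c k else 0)"
  by (simp add: span_poly_def coeff_sum)

lemma halfpow_mult_span_fun:
  assumes "z \<noteq> 0"
  shows "halfpow t0 (int N + 1) z * span_fun t0 N c z = poly (span_poly N c) z"
proof -
  have "halfpow t0 (int N + 1) z * halfpow t0 (2 * int k - (int N + 1)) z = z ^ k" for k
    using halfpow_add[OF assms, of t0 "int N + 1" "2 * int k - (int N + 1)"] halfpow_even[OF assms]
    by simp
  then show ?thesis
    unfolding span_fun_def poly_span_poly sum_distrib_left
    by (simp only: mult.left_commute)
qed

lemma span_fun_cis:
  assumes "t0 \<le> x" "x < t0 + 2 * pi"
  shows "span_fun t0 N c (cis x) = cis (- (real (N + 1) / 2) * x) * poly (span_poly N c) (cis x)"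
proof -
  have "cis (- (real (N + 1) / 2) * x) * halfpow t0 (int N + 1) (cis x) = 1"
    unfolding halfpow_cis[OF assms] cis_mult by (simp add: field_simps)
  moreover have "poly (span_poly N c) (cis x) = halfpow t0 (int N + 1) (cis x) * span_fun t0 N c (cis x)"
    by (rule halfpow_mult_span_fun[symmetric]) simp
  ultimately show ?thesis
    by (metis mult.assoc mult_1)
qed

text \<open>On the polynomial side the reflected function becomes the reversed polynomial with
  conjugate coefficients. Invariance of X thus turns into self-reciprocity.\<close>

lemma halfpow_mult_cnj_span_fun_reflect:
  assumes "z \<noteq> 0"
  shows "halfpow t0 (int N + 1) z * cnj (span_fun t0 N c (1 / cnj z))
    = poly (\<Sum>k\<le>N+1. monom (cnj (c k)) (N + 1 - k)) z"
proof -
  have *: "halfpow t0 (int N + 1) z * cnj (halfpow t0 (2 * int k - (int N + 1)) (1 / cnj z)) = z ^ (N + 1 - k)"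
    if "k \<le> N + 1" for k
  proof -
    have "int N + 1 + - (2 * int k - (int N + 1)) = 2 * int (N + 1 - k)"
      using that by (simp add: of_nat_diff)
    then show ?thesis
      by (metis halfpow_add[OF assms] halfpow_even[OF assms] cnj_halfpow_reflect[OF assms])
  qed
  have "halfpow t0 (int N + 1) z * cnj (span_fun t0 N c (1 / cnj z))
      = (\<Sum>k\<le>N+1. cnj (c k) * (halfpow t0 (int N + 1) z
          * cnj (halfpow t0 (2 * int k - (int N + 1)) (1 / cnj z))))"
    unfolding span_fun_def cnj_sum sum_distrib_left complex_cnj_mult by (simp only: mult.left_commute)
  also have "\<dots> = (\<Sum>k\<le>N+1. cnj (c k) * z ^ (N + 1 - k))"
    using * by (intro sum.cong refl) auto
  also have "\<dots> = poly (\<Sum>k\<le>N+1. monom (cnj (c k)) (N + 1 - k)) z"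
    by (simp only: poly_sum poly_monom)
  finally show ?thesis .
qed

lemma norm_halfpow_circle: "norm z = 1 \<Longrightarrow> norm (halfpow t0 k z) = 1"
  by (simp add: halfpow_def norm_mult)

lemma measurable_span_fun [measurable]: "span_fun t0 N c \<in> borel_measurable borel"
  unfolding span_fun_def by measurable

lemma norm_span_fun_circle:
  assumes "norm z = 1"
  shows "norm (span_fun t0 N c z) \<le> (\<Sum>k\<le>N+1. norm (c k))"
  unfolding span_fun_def
  by (rule sum_norm_le) (simp add: norm_mult norm_halfpow_circle[OF assms])

text \<open>For a unimodular square root \<open>s\<close> of \<open>\<tau>\<close> the number
  \<open>cnj s * u\<close> is its own conjugate, since \<open>cnj s * \<tau> = s\<close>.\<close>

lemma real_on_circle:
  assumes "u = \<tau> * cnj u" "norm \<tau> = 1"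
  shows "Im (cnj (csqrt \<tau>) * u) = 0"
proof -
  define s where "s = csqrt \<tau>"
  have s: "s * s = \<tau>" "cnj s * s = 1"
    using assms(2) power2_csqrt[of \<tau>]
    using complex_norm_square[of s] norm_csqrt[of \<tau>]
    by (simp_all add: s_def power2_eq_square mult.commute)
  have "cnj s * u = (cnj s * s) * s * cnj u"
    using assms(1) s(1) by (metis mult.assoc)
  also have "\<dots> = cnj (cnj s * u)"
    by (simp add: s(2))
  finally have "Im (cnj s * u) = - Im (cnj s * u)"
    by (metis cnj.sel(2))
  then show ?thesis
    unfolding s_def by linarith
qed

lemma nonneg_on_closed_interval:
  fixes f :: "real \<Rightarrow> real"
  assumes "a < b" "continuous_on UNIV f" "\<And>x. x \<in> {a<..<b} \<Longrightarrow> 0 \<le> f x" "x \<in> {a..b}"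
  shows "0 \<le> f x"
  using assms
  by (intro continuous_ge_on_closure[of "{a<..<b}" f x 0])
    (auto intro: continuous_on_subset)

section \<open>Zeros of odd order forced on a single arc\<close>

text \<open>With fewer zeros of odd order some test function makes the integrand keep one sign. Its
  integral is 0, so it vanishes almost everywhere, and the support would lie in a finite
  set.\<close>

lemma orthogonal_imp_odd_zeros:
  fixes M :: "complex measure"
  assumes borel: "sets M = sets borel" and fin: "finite_measure M"
    and supp: "infinite (msupp M)" "msupp M \<subseteq> arc a b"
    and ab: "t0 \<le> a" "b \<le> t0 + 2 * pi"
    and atom: "b = t0 + 2 * pi \<Longrightarrow> emeasure M {cis t0} = 0"
    and \<tau>: "norm \<tau> = 1"
    and inv: "\<And>z. norm z = 1 \<Longrightarrow> span_fun t0 N c z = \<tau> * cnj (span_fun t0 N c z)"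
    and orth: "\<And>m. m < n \<Longrightarrow>
      (LINT z|M. span_fun t0 N c z * halfpow t0 (int n - 1 - 2 * int m) z) = 0"
    and nz: "span_poly N c \<noteq> 0"
  shows "n \<le> card {x \<in> {a<..<b}. odd (order (cis x) (span_poly N c))}"
proof (rule ccontr)
  define P where "P = span_poly N c"
  define X where "X = span_fun t0 N c"
  define C where "C = cnj (csqrt \<tau>)"
  define S where "S = {x \<in> {a<..<b}. odd (order (cis x) P)}"
  define d where "d = real (N + 1) / 2"
  assume "\<not> ?thesis"
  then have cardS: "card S < n" by (simp add: S_def P_def)
  interpret finite_measure M by (rule fin)
  have [measurable_cong]: "sets M = sets borel" by (rule borel)
  have "a < b"
  proof (rule ccontr)
    assume "\<not> a < b"
    then have "arc a b \<subseteq> {cis a}" by (cases "a = b") (auto simp: arc_def)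
    then show False using supp by (meson finite.simps finite_subset)
  qed
  have b_le: "b \<le> a + 2 * pi" using ab by simp
  have C: "C \<noteq> 0" using \<tau> by (auto simp: C_def)
  have X_cis: "X (cis x) = cis (- d * x) * poly P (cis x)" if "t0 \<le> x" "x < t0 + 2 * pi" for x
    using span_fun_cis[OF that] by (simp add: X_def d_def P_def)
  have "P \<noteq> 0" using nz by (simp add: P_def)
  have realX: "Im (C * cis (- d * x) * poly P (cis x)) = 0" if "x \<in> {a<..<b}" for x
    using real_on_circle[OF inv \<tau>, of "cis x"] X_cis[of x] that ab by (simp add: C_def X_def mult.assoc)
  obtain e :: real where e: "e \<in> {1, - 1}"
    "\<And>x. x \<in> {a<..<b} \<Longrightarrow> 0 \<le> e * (Re (C * cis (- d * x) * poly P (cis x)) * (\<Prod>s\<in>S. sin ((x - s) / 2)))"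
    using constant_sign_odd_zeros[OF \<open>P \<noteq> 0\<close> C \<open>a < b\<close> b_le, of d] realX unfolding S_def by blast
  have finS: "finite S" using finite_odd_order[OF \<open>P \<noteq> 0\<close> b_le] by (simp add: S_def)
  \<comment> \<open>The available half powers have exponents in (n-1)/2 plus the integers, so the
    number of sine factors must have the parity of \<open>n - 1\<close>. If it does not, the
    endpoint \<open>a\<close> supplies one more factor, which is nonnegative on the arc;
    \<open>card S < n\<close> with an even difference leaves room for it.\<close>
  define S' where "S' = (if odd (n - card S) then S else insert a S)"
  have "a \<notin> S" by (simp add: S_def)
  have "card S + 2 \<le> n" if "even (n - card S)"
    using that cardS by presburger
  with \<open>a \<notin> S\<close> have S': "finite S'" "card S' \<le> n - 1" "even (n - 1 - card S')"
    using finS cardS by (force simp: S'_def)+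
  have sign_open: "0 \<le> e * (Re (C * cis (- d * x) * poly P (cis x)) * (\<Prod>s\<in>S'. sin ((x - s) / 2)))"
    if x: "x \<in> {a<..<b}" for x
  proof (cases "S' = S")
    case False
    have "0 \<le> sin ((x - a) / 2)"
      using x b_le by (intro sin_ge_zero) auto
    then have "0 \<le> e * (Re (C * cis (- d * x) * poly P (cis x)) * (\<Prod>s\<in>S. sin ((x - s) / 2)))
        * sin ((x - a) / 2)"
      using e(2)[OF x] by simp
    moreover have "S' = insert a S" using False by (auto simp: S'_def split: if_splits)
    ultimately show ?thesis
      using finS \<open>a \<notin> S\<close> by (simp add: mult_ac)
  qed (use e(2)[OF x] in simp)
  \<comment> \<open>The measure may charge the endpoints of the arc, so the closed interval is
    needed.\<close>
  have sign: "0 \<le> e * (Re (C * cis (- d * x) * poly P (cis x)) * (\<Prod>s\<in>S'. sin ((x - s) / 2)))"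
    if x: "x \<in> {a..b}" for x
    by (rule nonneg_on_closed_interval[OF \<open>a < b\<close> _ sign_open x]) (auto intro!: continuous_intros)
  obtain D :: "complex poly" where D: "degree D \<le> card S'"
    "\<And>x. complex_of_real (\<Prod>s\<in>S'. sin ((x - s) / 2)) = cis (- real (card S') * x / 2) * poly D (cis x)"
    using prod_sin_eq_poly[OF S'(1)] by blast
  \<comment> \<open>Multiplying \<open>D\<close> by the \<open>k\<close>-th power recentres the
    exponents: the prefactor for \<open>card S'\<close> becomes the one for
    \<open>n - 1\<close>.\<close>
  define k where "k = (n - 1 - card S') div 2"
  have k: "card S' + 2 * k = n - 1" using S'(2,3) by (simp add: k_def)
  define E where "E = monom 1 k * D"
  have degE: "degree E \<le> n - 1"
    using degree_mult_le[of "monom (1::complex) k" D] D(1) k by (simp add: E_def degree_monom_eq)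
  \<comment> \<open>As (n-1-2m)/2 = -(n-1)/2 + (n-1-m), the test function of index \<open>m\<close>
    carries the coefficient of \<open>E\<close> at \<open>n - Suc m\<close>.\<close>
  define h where "h = (\<lambda>z. \<Sum>m<n. coeff E (n - Suc m) * halfpow t0 (int n - 1 - 2 * int m) z)"
  have h_cis: "h (cis x) = complex_of_real (\<Prod>s\<in>S'. sin ((x - s) / 2))"
    if x: "t0 \<le> x" "x < t0 + 2 * pi" for x
  proof -
    have n: "n > 0" using cardS by simp
    have "h (cis x) = (\<Sum>m<n. coeff E (n - Suc m) * cis (- real (n - 1) * x / 2) * cis x ^ (n - Suc m))"
      unfolding h_def
    proof (rule sum.cong[OF refl])
      fix m assume m: "m \<in> {..<n}"
      have "halfpow t0 (int n - 1 - 2 * int m) (cis x)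
          = cis (- real (n - 1) * x / 2) * cis x ^ (n - Suc m)"
        using m n
        by (simp add: halfpow_cis[OF x] Complex.DeMoivre cis_mult of_nat_diff field_simps)
      then show "coeff E (n - Suc m) * halfpow t0 (int n - 1 - 2 * int m) (cis x)
          = coeff E (n - Suc m) * cis (- real (n - 1) * x / 2) * cis x ^ (n - Suc m)"
        by simp
    qed
    also have "\<dots> = (\<Sum>m<n. coeff E m * cis (- real (n - 1) * x / 2) * cis x ^ m)"
      by (rule sum.nat_diff_reindex)
    also have "\<dots> = cis (- real (n - 1) * x / 2) * (\<Sum>m\<le>n - 1. coeff E m * cis x ^ m)"
      using n by (simp add: sum_distrib_left mult_ac lessThan_Suc_atMost[symmetric])
    also have "(\<Sum>m\<le>n - 1. coeff E m * cis x ^ m) = poly E (cis x)"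
      unfolding poly_altdef using degE
      by (intro sum.mono_neutral_right) (auto simp: coeff_eq_0)
    also have "cis (- real (n - 1) * x / 2) * poly E (cis x)
        = (cis (- real (n - 1) * x / 2) * cis (real k * x)) * poly D (cis x)"
      by (simp add: E_def poly_monom Complex.DeMoivre)
    also have "cis (- real (n - 1) * x / 2) * cis (real k * x) = cis (- real (card S') * x / 2)"
      unfolding k[symmetric] by (simp add: cis_mult field_simps)
    finally show ?thesis by (simp only: D(2))
  qed
  define F where "F = (\<lambda>z. C * X z * h z)"
  have [measurable]: "X \<in> borel_measurable borel" unfolding X_def by measurable
  have AE_arc: "AE z in M. z \<in> msupp M"
    using AE_not_in[OF compl_msupp_null_set[OF borel]] by simp
  \<comment> \<open>The branch reads \<open>cis t0\<close> at the angle \<open>t0\<close>, never at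
    \<open>t0 + 2 * pi\<close>, where half powers may differ in sign. When the arc reaches that
    angle, the absence of an atom discards the point.\<close>
  have AE_cis: "AE z in M. \<exists>x\<in>{a..b}. x < t0 + 2 * pi \<and> z = cis x"
  proof -
    have "AE z in M. b = t0 + 2 * pi \<longrightarrow> z \<noteq> cis t0"
    proof (cases "b = t0 + 2 * pi")
      case True
      have "{cis t0} \<in> null_sets M" using atom[OF True] borel by (auto simp: null_sets_def)
      then show ?thesis using AE_not_in[of "{cis t0}" M] by auto
    qed simp
    with AE_arc show ?thesis
    proof eventually_elim
      case (elim z)
      then obtain x where x: "x \<in> {a..b}" "z = cis x" using supp(2) by (auto simp: arc_def)
      have "x \<noteq> t0 + 2 * pi"
      proof
        assume "x = t0 + 2 * pi"
        then have "b = t0 + 2 * pi" "z = cis t0" using x ab by (auto simp: cis_mult[symmetric])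
        then show False using elim by simp
      qed
      then show ?case using x ab by (intro bexI[of _ x]) auto
    qed
  qed
  have int_F: "integrable M F" "(LINT z|M. F z) = 0"
  proof -
    \<comment> \<open>On the circle \<open>X\<close> and the half powers are bounded, and the finite
      measure is concentrated there.\<close>
    have int: "integrable M (\<lambda>z. X z * halfpow t0 l z)" for l
    proof (rule integrable_const_bound)
      show "AE z in M. norm (X z * halfpow t0 l z) \<le> (\<Sum>k\<le>N+1. norm (c k))"
        using AE_cis
      proof eventually_elim
        case (elim z)
        then have "norm z = 1" by auto
        then show ?case
          using norm_span_fun_circle[of z t0 N c] by (simp add: X_def norm_mult norm_halfpow_circle)
      qed
    qed measurable
    have F_eq: "F = (\<lambda>z. \<Sum>m<n. (C * coeff E (n - Suc m)) * (X z * halfpow t0 (int n - 1 - 2 * int m) z))"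
      by (simp add: F_def h_def sum_distrib_left mult_ac)
    show "integrable M F" unfolding F_eq by (intro Bochner_Integration.integrable_sum integrable_mult_right int)
    show "(LINT z|M. F z) = 0"
      unfolding F_eq
      by (subst Bochner_Integration.integral_sum) (auto simp: X_def orth intro!: integrable_mult_right int[unfolded X_def])
  qed
  have F_cis: "F (cis x) = complex_of_real (Re (C * cis (- d * x) * poly P (cis x)) * (\<Prod>s\<in>S'. sin ((x - s) / 2)))"
    if x: "x \<in> {a..b}" "x < t0 + 2 * pi" for x
  proof -
    have x': "t0 \<le> x" using x ab by simp
    have "Im (C * X (cis x)) = 0"
      using real_on_circle[OF inv \<tau>, of "cis x"] by (simp add: C_def X_def)
    then have "C * X (cis x) = complex_of_real (Re (C * X (cis x)))"
      by (simp add: complex_eq_iff)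
    then show ?thesis
      unfolding F_def h_cis[OF x' x(2)] X_cis[OF x' x(2)] of_real_mult mult.assoc by simp
  qed
  have "AE z in M. e * Re (F z) = 0"
  proof (subst integral_nonneg_eq_0_iff_AE[symmetric])
    show "integrable M (\<lambda>z. e * Re (F z))" using int_F(1) by simp
    show "AE z in M. 0 \<le> e * Re (F z)"
      using AE_cis
    proof eventually_elim
      case (elim z)
      then obtain x where x: "x \<in> {a..b}" "x < t0 + 2 * pi" "z = cis x" by blast
      show ?case
        unfolding x(3) F_cis[OF x(1,2)] Re_complex_of_real by (rule sign[OF x(1)])
    qed
    show "(LINT z|M. e * Re (F z)) = 0" using int_F by simp
  qed
  \<comment> \<open>A zero of \<open>F\<close> on the arc is a root of \<open>P\<close> or a point
    with angle in \<open>S'\<close>; both sets are finite, hence closed.\<close>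
  with AE_cis have "AE z in M. z \<in> {z. poly P z = 0} \<union> cis ` S'"
  proof eventually_elim
    case (elim z)
    then obtain x where x: "x \<in> {a..b}" "x < t0 + 2 * pi" "z = cis x" by blast
    have "Re (F z) = 0" using elim(2) e(1) by auto
    moreover have "Im (F z) = 0" unfolding x(3) F_cis[OF x(1,2)] by (rule Im_complex_of_real)
    ultimately have "F z = 0" by (simp add: complex_eq_iff)
    then consider "X (cis x) = 0" | "h (cis x) = 0" using C by (auto simp: F_def x(3))
    then show ?case
    proof cases
      case 1
      then show ?thesis using X_cis[of x] x ab by simp
    next
      case 2
      then obtain s where s: "s \<in> S'" "sin ((x - s) / 2) = 0"
        using h_cis[of x] x ab S'(1) by (auto simp del: of_real_prod)
      then have "cis x = cis s" using cis_diff_eq[of x s] by simp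
      then show ?thesis using s(1) x(3) by blast
    qed
  qed
  moreover have "finite ({z. poly P z = 0} \<union> cis ` S')"
    using poly_roots_finite[OF \<open>P \<noteq> 0\<close>] S'(1) by simp
  ultimately have "msupp M \<subseteq> {z. poly P z = 0} \<union> cis ` S'"
    by (intro msupp_subset_closed[OF borel] finite_imp_closed)
  with \<open>finite ({z. poly P z = 0} \<union> cis ` S')\<close> have "finite (msupp M)"
    by (rule rev_finite_subset)
  then show False using supp(1) by simp
qed

section \<open>Root counting for self-reciprocal polynomials\<close>

lemma prod_linear_dvd:
  fixes P :: "'a :: idom poly"
  assumes "finite Z" "\<And>z. z \<in> Z \<Longrightarrow> poly P z = 0"
  shows "(\<Prod>z\<in>Z. [:- z, 1:]) dvd P"
  using assms
proof (induction Z rule: finite_induct)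
  case (insert w Z)
  then obtain Q where Q: "P = (\<Prod>z\<in>Z. [:- z, 1:]) * Q"
    by (auto simp: dvd_def)
  have "poly (\<Prod>z\<in>Z. [:- z, 1:]) w \<noteq> 0"
    using insert.hyps by (auto simp: poly_prod)
  then have "[:- w, 1:] dvd Q"
    using insert.prems[of w] unfolding Q by (simp add: poly_eq_0_iff_dvd)
  then show ?case
    using insert.hyps unfolding Q by (metis mult.commute mult_dvd_mono dvd_refl prod.insert)
qed simp

text \<open>Self-reciprocity enters through \<open>lead\<close> and \<open>reflect\<close>. By
  \<open>lead\<close>, a drop in degree would make 0 a root besides the \<open>N\<close> roots in
  \<open>Z\<close>, too many for the degree. Hence the cofactor of the roots in \<open>Z\<close> is
  linear and leaves a single root \<open>w\<close> to locate.\<close>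

lemma self_reflective_poly_roots:
  fixes P :: "complex poly"
  assumes "P \<noteq> 0" "degree P \<le> N + 1"
    and lead: "coeff P (N + 1) = 0 \<longleftrightarrow> poly P 0 = 0"
    and reflect: "\<And>z. z \<noteq> 0 \<Longrightarrow> poly P z = 0 \<Longrightarrow> poly P (1 / cnj z) = 0"
    and Z: "finite Z" "card Z = N" "\<And>z. z \<in> Z \<Longrightarrow> norm z = 1 \<and> odd (order z P)"
  shows "degree P = N + 1" "card {z. poly P z = 0} = N + 1"
    "poly P z = 0 \<Longrightarrow> order z P = 1 \<and> norm z = 1"
proof -
  define R where "R = {z. poly P z = 0}"
  have finR: "finite R" using poly_roots_finite[OF assms(1)] by (simp add: R_def)
  have ZR: "Z \<subseteq> R"
    using Z(3) assms(1) by (auto simp: R_def order_root intro!: odd_pos)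
  have "0 \<notin> Z" using Z(3) by force
  show deg: "degree P = N + 1"
  proof (rule ccontr)
    assume "degree P \<noteq> N + 1"
    then have less: "degree P < N + 1" using assms(2) by simp
    then have "insert 0 Z \<subseteq> R" using lead ZR coeff_eq_0[OF less] by (simp add: R_def)
    then have "N + 1 \<le> card R" using card_mono[OF finR, of "insert 0 Z"] Z(1,2) \<open>0 \<notin> Z\<close> by simp
    then show False using card_poly_roots_bound[OF assms(1)] less by (simp add: R_def)
  qed
  have order_pos: "order z P \<ge> 1" if "z \<in> R" for z
    using that assms(1) by (simp add: R_def order_root)
  have sum_le: "(\<Sum>z\<in>R. order z P) \<le> N + 1"
    using sum_order_le_degree[OF assms(1)] deg by (simp add: R_def)
  define L where "L = (\<Prod>z\<in>Z. [:- z, 1:])"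
  have degL: "degree L = N"
    using Z(2) by (simp add: L_def degree_prod_eq_sum_degree)
  have "L dvd P"
    using prod_linear_dvd[OF Z(1)] ZR by (auto simp: L_def R_def)
  then obtain Q where Q: "P = L * Q" by (auto simp: dvd_def)
  have "degree Q = 1"
    using degree_mult_eq[of L Q] assms(1) Q deg degL by auto
  then have "poly Q (- coeff Q 0 / coeff Q 1) = 0"
    using leading_coeff_0_iff[of Q] by (auto simp: poly_altdef)
  then obtain w where w: "poly Q w = 0" by blast
  have wR: "w \<in> R" by (simp add: R_def Q w)
  have "w \<notin> Z"
  proof
    assume wZ: "w \<in> Z"
    have "order w P = order w L + order w Q"
      using assms(1) unfolding Q by (rule order_mult)
    moreover have "poly L w = 0"
      using wZ Z(1) by (auto simp: L_def poly_prod)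
    then have "order w L \<ge> 1" "order w Q \<ge> 1"
      using assms(1) w by (auto simp: Q order_root)
    ultimately have "order w P \<ge> 2" by simp
    \<comment> \<open>Oddness lifts the order from 2 to 3, which brings the total multiplicity to at
      least \<open>N + 2\<close>.\<close>
    then have "order w P \<ge> 3" using Z(3)[OF wZ] by (cases "order w P = 2") auto
    have "N + 2 = 3 + (\<Sum>z\<in>Z - {w}. 1)"
      using wZ Z(1,2) card_gt_0_iff[of Z] by (auto simp: card_Diff_singleton)
    also have "\<dots> \<le> order w P + (\<Sum>z\<in>Z - {w}. order z P)"
      using \<open>order w P \<ge> 3\<close> order_pos ZR by (intro add_mono sum_mono) auto
    also have "\<dots> = (\<Sum>z\<in>Z. order z P)" using wZ Z(1) by (simp add: sum.remove)
    also have "\<dots> \<le> (\<Sum>z\<in>R. order z P)" using ZR finR by (intro sum_mono2) auto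
    finally show False using sum_le by simp
  qed
  have "card R \<le> N + 1" using card_poly_roots_bound[OF assms(1)] deg by (simp add: R_def)
  then have R: "R = insert w Z"
    using card_seteq[OF finR, of "insert w Z"] wR ZR Z(1,2) \<open>w \<notin> Z\<close> by simp
  then have cardR: "card R = N + 1" using Z(1,2) \<open>w \<notin> Z\<close> by simp
  then show "card {z. poly P z = 0} = N + 1" by (simp add: R_def)
  have "0 \<notin> R"
    using lead deg assms(1) leading_coeff_0_iff[of P] by (auto simp: R_def)
  have "norm w = 1"
  proof (rule ccontr)
    assume nw: "norm w \<noteq> 1"
    have w0: "w \<noteq> 0" using wR \<open>0 \<notin> R\<close> by auto
    \<comment> \<open>Off the circle the reflected root cannot be in \<open>Z\<close>, so it must be
      \<open>w\<close> again; but reflection fixes only points of the circle.\<close>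
    have "1 / cnj w \<in> R" using reflect[OF w0] wR by (simp add: R_def)
    moreover have "norm (1 / cnj w) \<noteq> 1" using nw by (simp add: norm_divide)
    then have "1 / cnj w \<notin> Z" using Z(3) by blast
    ultimately have "1 / cnj w = w" by (simp add: R)
    then have "norm w * norm w = 1" using w0 by (metis norm_divide norm_one complex_mod_cnj nonzero_divide_eq_eq norm_eq_zero)
    then show False using nw by (metis abs_norm_cancel abs_1 real_sqrt_abs2 real_sqrt_one)
  qed
  assume "poly P z = 0"
  then have zR: "z \<in> R" by (simp add: R_def)
  have "order z P = 1"
  proof (rule ccontr)
    assume "order z P \<noteq> 1"
    then have "order z P > 1" using order_pos[OF zR] by simp
    \<comment> \<open>There are \<open>N + 1\<close> distinct roots and the orders sum to at most
      \<open>N + 1\<close>, so no order can exceed 1.\<close>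
    then have "(\<Sum>z\<in>R. 1) < (\<Sum>z\<in>R. order z P)"
      using zR order_pos finR by (intro sum_strict_mono_ex1) auto
    then show False using sum_le cardR by simp
  qed
  then show "order z P = 1 \<and> norm z = 1" using zR R Z(3) \<open>norm w = 1\<close> by auto
qed

text \<open>The half-power identities hold only away from 0; infinitely many points remain, enough
  to determine a polynomial.\<close>

lemma poly_eqI_nonzero:
  fixes p q :: "'a :: {field_char_0} poly"
  assumes "\<And>z. z \<noteq> 0 \<Longrightarrow> poly p z = poly q z"
  shows "p = q"
proof (rule ccontr)
  assume "p \<noteq> q"
  then have "finite {z. poly (p - q) z = 0}"
    by (intro poly_roots_finite) simp
  moreover have "UNIV - {0} \<subseteq> {z. poly (p - q) z = 0}"
    using assms by auto
  ultimately have "finite (UNIV - {0 :: 'a})"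
    by (rule rev_finite_subset)
  then show False
    by (simp add: infinite_UNIV_char_0)
qed

section \<open>Combining all arcs\<close>

theorem theorem4p5:
  fixes r :: nat and a b :: "nat \<Rightarrow> real" and t0 :: real
    and \<mu> :: "nat \<Rightarrow> complex measure" and n :: "nat \<Rightarrow> nat"
    and \<tau> :: complex and c :: "nat \<Rightarrow> complex"
  assumes r_pos: "r \<ge> 1"
    and arcs_ab: "\<forall>j\<in>{1..r}. a j \<le> b j"
    and arcs_first: "t0 \<le> a 1"
    and arcs_order: "\<forall>j\<in>{1..<r}. b j \<le> a (Suc j)"
    and arcs_last: "b r \<le> t0 + 2 * pi"
    and meas_borel: "\<forall>j\<in>{1..r}. sets (\<mu> j) = sets borel"
    and meas_finite: "\<forall>j\<in>{1..r}. finite_measure (\<mu> j)"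
    and supp_inf: "\<forall>j\<in>{1..r}. infinite (msupp (\<mu> j))"
    and supp_arc: "\<forall>j\<in>{1..r}. msupp (\<mu> j) \<subseteq> arc (a j) (b j)"
    and no_atom: "emeasure (\<mu> r) {cis t0} = 0"
    and tau: "norm \<tau> = 1"
    and inv: "\<forall>z. z \<noteq> 0 \<longrightarrow>
        span_fun t0 (\<Sum>j=1..r. n j) c z = \<tau> * cnj (span_fun t0 (\<Sum>j=1..r. n j) c (1 / cnj z))"
    and orth: "\<forall>j\<in>{1..r}. \<forall>m<n j.
        (LINT z|\<mu> j. span_fun t0 (\<Sum>j=1..r. n j) c z
                      * halfpow t0 (int (n j) - 1 - 2 * int m) z) = 0"
    and nonzero: "\<exists>z. z \<noteq> 0 \<and> span_fun t0 (\<Sum>j=1..r. n j) c z \<noteq> 0"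
  shows "\<exists>p :: complex poly.
     (\<forall>z. z \<noteq> 0 \<longrightarrow> poly p z = halfpow t0 (int (\<Sum>j=1..r. n j) + 1) z * span_fun t0 (\<Sum>j=1..r. n j) c z)
     \<and> p \<noteq> 0
     \<and> degree p = (\<Sum>j=1..r. n j) + 1
     \<and> card {z. poly p z = 0} = (\<Sum>j=1..r. n j) + 1
     \<and> (\<forall>z. poly p z = 0 \<longrightarrow> order z p = 1 \<and> norm z = 1)
     \<and> card ({z. poly p z = 0} - (\<Union>j\<in>{1..r}. arc_int (a j) (b j))) \<le> 1"
proof -
  define N where "N = (\<Sum>j=1..r. n j)"
  define X where "X = span_fun t0 N c"
  define P where "P = span_poly N c"
  define T where "T = (\<lambda>j. {x \<in> {a j<..<b j}. odd (order (cis x) P)})"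
  have P_eq: "poly P z = halfpow t0 (int N + 1) z * X z" if "z \<noteq> 0" for z
    using halfpow_mult_span_fun[OF that] by (simp add: P_def X_def)
  have halfpow_nz: "halfpow t0 k z \<noteq> 0" if "z \<noteq> 0" for k z
    using that by (simp add: halfpow_def)
  have "P \<noteq> 0"
    using nonzero P_eq halfpow_nz by (force simp: X_def N_def)
  have X_inv: "X z = \<tau> * cnj (X (1 / cnj z))" if "z \<noteq> 0" for z
    using inv that unfolding X_def N_def by blast
  have reflect: "poly P (1 / cnj z) = 0" if "z \<noteq> 0" "poly P z = 0" for z
  proof -
    have "X z = 0" using that P_eq halfpow_nz by simp
    then have "X (1 / cnj z) = 0"
      using X_inv[OF that(1)] tau by auto
    then show ?thesis using P_eq[of "1 / cnj z"] that(1) by simp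
  qed
  \<comment> \<open>Comparing constant coefficients in this identity ties \<open>c 0\<close> to the
    conjugate of \<open>c (N + 1)\<close>, so they vanish together; this is
    \<open>lead\<close>.\<close>
  have "P = smult \<tau> (\<Sum>k\<le>N+1. monom (cnj (c k)) (N + 1 - k))"
  proof (rule poly_eqI_nonzero)
    fix z :: complex assume z: "z \<noteq> 0"
    show "poly P z = poly (smult \<tau> (\<Sum>k\<le>N+1. monom (cnj (c k)) (N + 1 - k))) z"
      unfolding poly_smult halfpow_mult_cnj_span_fun_reflect[OF z, of t0, symmetric] P_eq[OF z]
      by (subst X_inv[OF z]) (simp only: X_def mult.left_commute)
  qed
  then have "coeff P 0 = coeff (smult \<tau> (\<Sum>k\<le>N+1. monom (cnj (c k)) (N + 1 - k))) 0"
    by (rule arg_cong)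
  then have "coeff P 0 = \<tau> * (\<Sum>k\<le>N+1. if N + 1 - k = 0 then cnj (c k) else 0)"
    by (simp only: coeff_smult coeff_sum coeff_monom)
  also have "(\<Sum>k\<le>N+1. if N + 1 - k = 0 then cnj (c k) else 0) = (\<Sum>k\<in>{N+1}. cnj (c k))"
    by (intro sum.mono_neutral_cong_right) auto
  finally have lead: "coeff P (N + 1) = 0 \<longleftrightarrow> poly P 0 = 0"
    using tau by (auto simp: P_def coeff_span_poly poly_0_coeff_0)
  have deg: "degree P \<le> N + 1"
    by (rule degree_le) (simp add: P_def coeff_span_poly)
  have ordered: "b i \<le> a j" if "1 \<le> i" "i < j" "j \<le> r" for i j
    using that(2,3)
  proof (induction j)
    case (Suc j)
    have *: "b j \<le> a (Suc j)" using arcs_order Suc.prems that(1) by simp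
    show ?case
    proof (cases "i = j")
      case False
      then have "b i \<le> a j" using Suc by simp
      also have "a j \<le> b j" using arcs_ab Suc.prems that(1) False by simp
      finally show ?thesis using * by simp
    qed (use * in simp)
  qed simp
  have lower: "t0 \<le> a j" if j: "j \<in> {1..r}" for j
  proof (cases "j = 1")
    case False
    then have "b 1 \<le> a j" using j ordered[of 1 j] by simp
    moreover have "a 1 \<le> b 1" using arcs_ab j by simp
    ultimately show ?thesis using arcs_first by simp
  qed (use arcs_first in simp)
  have upper_r: "b j \<le> a r" if "j \<in> {1..r}" "j \<noteq> r" for j
    using that ordered[of j r] by simp
  have upper: "b j \<le> t0 + 2 * pi" if j: "j \<in> {1..r}" for j
  proof (cases "j = r")
    case False
    then have "b j \<le> a r" using upper_r j by simp
    moreover have "a r \<le> b r" using arcs_ab r_pos by simp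
    ultimately show ?thesis using arcs_last by simp
  qed (use arcs_last in simp)
  have atom: "emeasure (\<mu> j) {cis t0} = 0" if j: "j \<in> {1..r}" and "b j = t0 + 2 * pi" for j
  proof (cases "j = r")
    case False
    \<comment> \<open>An earlier arc that reaches \<open>t0 + 2 * pi\<close> squeezes the last arc
      to a point, which cannot hold an infinite support.\<close>
    then have "a r \<ge> b r" using upper_r[OF j] that(2) arcs_last by simp
    then have "a r = b r" using arcs_ab r_pos by (simp add: order_antisym)
    then have "arc (a r) (b r) \<subseteq> {cis (a r)}" by (simp add: arc_def)
    then have "finite (msupp (\<mu> r))"
      using supp_arc r_pos by (meson atLeastAtMost_iff finite.simps finite_subset order_refl subset_trans)
    then show ?thesis using supp_inf r_pos by simp
  qed (use no_atom in simp)
  have card_T: "n j \<le> card (T j)" if j: "j \<in> {1..r}" for j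
    unfolding T_def P_def
  proof (rule orthogonal_imp_odd_zeros[where ?t0.0 = t0 and \<tau> = \<tau> and M = "\<mu> j"])
    show "span_fun t0 N c z = \<tau> * cnj (span_fun t0 N c z)" if "norm z = 1" for z
    proof -
      \<comment> \<open>Reflection fixes the circle pointwise, so there the invariance relates
        \<open>X z\<close> to its own conjugate.\<close>
      have "1 / cnj z = z"
        using that complex_norm_square[of z] by (auto simp: divide_eq_eq)
      moreover have "z \<noteq> 0" using that by auto
      ultimately show ?thesis using X_inv[of z] by (simp add: X_def)
    qed
    show "span_poly N c \<noteq> 0" using \<open>P \<noteq> 0\<close> by (simp add: P_def)
    show "(LINT z|\<mu> j. span_fun t0 N c z * halfpow t0 (int (n j) - 1 - 2 * int m) z) = 0" if "m < n j" for m
      using orth j that unfolding N_def by blast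
  qed (use j meas_borel meas_finite supp_inf supp_arc lower upper atom tau in auto)
  have fin_T: "finite (T j)" if "j \<in> {1..r}" for j
    unfolding T_def using lower[OF that] upper[OF that] by (intro finite_odd_order[OF \<open>P \<noteq> 0\<close>]) simp
  define U where "U = (\<Union>j\<in>{1..r}. T j)"
  have "T i \<inter> T j = {}" if "i \<in> {1..r}" "j \<in> {1..r}" "i \<noteq> j" for i j
    using that ordered[of i j] ordered[of j i] by (cases "i < j") (auto simp: T_def)
  then have "card U = (\<Sum>j=1..r. card (T j))"
    unfolding U_def using fin_T by (intro card_UN_disjoint) auto
  then have "N \<le> card U"
    unfolding N_def by (simp only: sum_mono card_T)
  \<comment> \<open>All the open arcs lie in one open window of length \<open>2 * pi\<close>, so
    distinct angles give distinct points.\<close>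
  have "inj_on cis U"
  proof (rule inj_on_subset[OF inj_on_cis_interval])
    show "U \<subseteq> {t0<..<t0 + 2 * pi}"
      using lower upper by (force simp: U_def T_def)
  qed simp
  then have "N \<le> card (cis ` U)"
    using \<open>N \<le> card U\<close> by (simp add: card_image)
  \<comment> \<open>The arcs may contain all \<open>N + 1\<close> roots; exactly \<open>N\<close> of
    them are kept, so that a single root is left outside \<open>Z\<close>.\<close>
  then obtain Z where Z: "Z \<subseteq> cis ` U" "card Z = N" "finite Z"
    by (metis obtain_subset_with_card_n)
  have Z_odd: "norm z = 1 \<and> odd (order z P)" if "z \<in> Z" for z
    using that Z(1) by (auto simp: U_def T_def)
  have Z_arc: "Z \<subseteq> (\<Union>j\<in>{1..r}. arc_int (a j) (b j))"
    using Z(1) by (fastforce simp: U_def T_def arc_int_def)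
  note roots = self_reflective_poly_roots[OF \<open>P \<noteq> 0\<close> deg lead reflect Z(3,2) Z_odd]
  have "Z \<subseteq> {z. poly P z = 0}"
    using Z_odd \<open>P \<noteq> 0\<close> by (auto simp: order_root intro!: odd_pos)
  then have "card ({z. poly P z = 0} - Z) = 1"
    using roots(2) Z(2,3) by (simp add: card_Diff_subset)
  moreover have "card ({z. poly P z = 0} - (\<Union>j\<in>{1..r}. arc_int (a j) (b j))) \<le> card ({z. poly P z = 0} - Z)"
    using Z_arc poly_roots_finite[OF \<open>P \<noteq> 0\<close>] by (intro card_mono) auto
  ultimately have "card ({z. poly P z = 0} - (\<Union>j\<in>{1..r}. arc_int (a j) (b j))) \<le> 1"
    by simp
  then show ?thesis
    using P_eq \<open>P \<noteq> 0\<close> roots unfolding N_def[symmetric] X_def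
    by (intro exI[of _ P]) blast
qed

end
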